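(* Let $n \ge 1$ be an integer and let $$P(x_1,\ldots,x_n,y_1,\ldots,y_n) = \prod_{i=1}^n (x_i^n + y_i^n) - \left(\prod_{i=1}^n x_i + \prod_{i=1}^n y_i\right)^n \in \mathbb{R}[x_1,\dots,x_n,y_1,\dots,y_n].$$ Then $P \in S_{2n}$.
   Context: $S_{2n} \subseteq \mathbb{R}[x_1,\dots,x_n,y_1,\dots,y_n]$ denotes the set of all polynomials of the form $\sum_{\varepsilon \in \{0,1\}^{n}}\sum_{\delta\in\{0,1\}^n} r_{\varepsilon,\delta} \prod_{j=1}^n x_j^{\varepsilon_j} y_j^{\delta_j}$, where each $r_{\varepsilon,\delta}$ is a (finite) sum of squares of polynomials in $\mathbb{R}[x_1,\dots,x_n,y_1,\dots,y_n]$. Equivalently, $S_{2n}$ is the semiring generated by the $2n$ variables $x_1,\dots,x_n,y_1,\dots,y_n$ and the squares of all polynomials in these variables. *)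

theory Defs
  imports Complex_Main "HOL-Library.Poly_Mapping" "HOL-Library.FuncSet"
begin

text \<open>
  Monomials are finitely supported exponent functions, polynomials are finitely supported
  coefficient functions on monomials; multiplication on \<^typ>\<open>'a \<Rightarrow>\<^sub>0 'b\<close>
  is convolution.
\<close>

datatype var = XVar nat | YVar nat

type_synonym rpoly = "(var \<Rightarrow>\<^sub>0 nat) \<Rightarrow>\<^sub>0 real"

definition indet :: "var \<Rightarrow> rpoly" where
  "indet v = Poly_Mapping.single (Poly_Mapping.single v 1) 1"

abbreviation xvar :: "nat \<Rightarrow> rpoly" where
  "xvar i \<equiv> indet (XVar i)"

abbreviation yvar :: "nat \<Rightarrow> rpoly" where
  "yvar i \<equiv> indet (YVar i)"

text \<open>
  The type \<^typ>\<open>rpoly\<close> has infinitely many indeterminates; the set below is the subring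
  of the polynomials in which only \<open>xvar 1, \<dots>, xvar n, yvar 1, \<dots>, yvar n\<close> occur.
\<close>

definition poly_ring :: "nat \<Rightarrow> rpoly set" where
  "poly_ring n = {p. \<forall>m \<in> Poly_Mapping.keys p. Poly_Mapping.keys m \<subseteq> XVar ` {1..n} \<union> YVar ` {1..n}}"

definition sums_of_squares :: "nat \<Rightarrow> rpoly set" where
  "sums_of_squares n = {\<Sum>i<k. (q i)\<^sup>2 | (k :: nat) q. \<forall>i<k. q i \<in> poly_ring n}"

text \<open>
  The number of variables is \<open>2 * n\<close>. The exponent vectors in \<open>{0,1}\<^sup>n\<close> are extensional
  functions on \<open>{1..n}\<close>, so that each of them is counted once.
\<close>

definition S2 :: "nat \<Rightarrow> rpoly set" where
  "S2 n = {\<Sum>\<epsilon> \<in> {1..n} \<rightarrow>\<^sub>E {0, 1 :: nat}. \<Sum>\<delta> \<in> {1..n} \<rightarrow>\<^sub>E {0, 1 :: nat}.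
             r \<epsilon> \<delta> * (\<Prod>j = 1..n. xvar j ^ \<epsilon> j * yvar j ^ \<delta> j) | r.
           \<forall>\<epsilon> \<in> {1..n} \<rightarrow>\<^sub>E {0, 1}. \<forall>\<delta> \<in> {1..n} \<rightarrow>\<^sub>E {0, 1}.
             r \<epsilon> \<delta> \<in> sums_of_squares n}"

definition prod_pow_diff :: "nat \<Rightarrow> rpoly" where
  "prod_pow_diff n = (\<Prod>i = 1..n. xvar i ^ n + yvar i ^ n) - ((\<Prod>i = 1..n. xvar i) + (\<Prod>i = 1..n. yvar i)) ^ n"

end

theory Submission
  imports Defs "HOL-Combinatorics.Permutations"
begin

text \<open>
  Write \<open>x\<^sub>A = (\<Prod>i\<in>A. x\<^sub>i)\<close>. Expanding both products of \<^term>\<open>prod_pow_diff n\<close> over the subsets \<open>A\<close>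
  of \<open>{1..n}\<close> compares \<open>x\<^sub>A\<^sup>n y\<^sub>B\<^sup>n\<close>, where \<open>B\<close> is the complement of \<open>A\<close>, with
  \<open>(\<Prod>i. x\<^sub>i)\<^bsup>|A|\<^esup> (\<Prod>i. y\<^sub>i)\<^bsup>|B|\<^esup>\<close>. The difference need not be in the semiring for a single \<open>A\<close>, but it
  is after symmetrization over the permutations of the indices, and this is an instance of
  Muirhead's inequality. For an exponent vector \<open>\<alpha>\<close> with entries at most \<open>n\<close>, let \<open>T \<alpha>\<close> be the
  sum of \<open>\<Prod>i. x\<^bsub>\<pi> i\<^esub>\<^bsup>\<alpha> i\<^esup> y\<^bsub>\<pi> i\<^esub>\<^bsup>n - \<alpha> i\<^esup>\<close> over all permutations \<open>\<pi>\<close>. The two monomials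
  belonging to \<open>A\<close> symmetrize to \<open>T \<alpha>\<close> for the vector \<open>\<alpha>\<close> that is \<open>n\<close> on \<open>A\<close> and \<open>0\<close> elsewhere, and
  to \<open>T\<close> of the constant vector with the same mean \<open>|A|\<close>.

  A vector is levelled to its mean by moving single units from an entry above the mean to one below
  it. Pairing each permutation with its composite with the transposition of the two positions shows
  that such a step lowers \<open>T\<close> by one half of a sum of monomials times expressions
  \<open>u\<^bsup>d+2\<^esup> + v\<^bsup>d+2\<^esup> - u\<^bsup>d+1\<^esup> v - v\<^bsup>d+1\<^esup> u = (u - v)\<^sup>2 (\<Sum>i\<le>d. u\<^bsup>i\<^esup> v\<^bsup>d-i\<^esup>)\<close>
  with \<open>u = x\<^sub>p y\<^sub>q\<close> and \<open>v = x\<^sub>q y\<^sub>p\<close>. This is \<open>sym_monomial_transfer\<close>; the levelling is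
  \<open>sym_monomial_level\<close>, and the sum over \<open>A\<close> gives \<open>n!\<close> times the polynomial in
  \<open>prod_power_add_diff\<close>. Division by \<open>2\<close> and by \<open>n!\<close> is possible because positive
  constants are squares.
\<close>

section \<open>Muirhead's inequality in a divisible semiring\<close>

text \<open>
  The argument uses of the polynomial semiring only the closure properties below. The cross
  differences are the only squares that occur in it.
\<close>

locale cross_square_semiring =
  fixes S :: "'a::comm_ring_1 set" and x y :: "'i \<Rightarrow> 'a" and I :: "'i set"
  assumes one: "1 \<in> S"
    and zero: "0 \<in> S"
    and add: "p \<in> S \<Longrightarrow> q \<in> S \<Longrightarrow> p + q \<in> S"
    and mult: "p \<in> S \<Longrightarrow> q \<in> S \<Longrightarrow> p * q \<in> S"
    and divide: "0 < m \<Longrightarrow> of_nat m * p \<in> S \<Longrightarrow> p \<in> S"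
    and x: "i \<in> I \<Longrightarrow> x i \<in> S"
    and y: "i \<in> I \<Longrightarrow> y i \<in> S"
    and cross_square: "i \<in> I \<Longrightarrow> j \<in> I \<Longrightarrow> (x i * y j - x j * y i)\<^sup>2 \<in> S"
    and finite: "finite I"
begin

lemma power: "p \<in> S \<Longrightarrow> p ^ k \<in> S"
  by (induction k) (auto intro: one mult)

lemma sum: "(\<And>i. i \<in> A \<Longrightarrow> f i \<in> S) \<Longrightarrow> sum f A \<in> S"
  by (induction A rule: infinite_finite_induct) (auto intro: zero add)

lemma prod: "(\<And>i. i \<in> A \<Longrightarrow> f i \<in> S) \<Longrightarrow> prod f A \<in> S"
  by (induction A rule: infinite_finite_induct) (auto intro: one mult)

definition sym_monomial :: "nat \<Rightarrow> ('i \<Rightarrow> nat) \<Rightarrow> 'a" where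
  "sym_monomial N \<alpha> = (\<Sum>\<pi> | \<pi> permutes I. \<Prod>i\<in>I. x (\<pi> i) ^ \<alpha> i * y (\<pi> i) ^ (N - \<alpha> i))"

lemma sym_monomial_cong: "(\<And>i. i \<in> I \<Longrightarrow> \<alpha> i = \<beta> i) \<Longrightarrow> sym_monomial N \<alpha> = sym_monomial N \<beta>"
  by (simp add: sym_monomial_def)

text \<open>
  The two-variable case of the transfer: with \<open>u = x\<^sub>p y\<^sub>q\<close> and \<open>v = x\<^sub>q y\<^sub>p\<close> the expression is a
  monomial times \<open>(u - v) * (u\<^bsup>d+1\<^esup> - v\<^bsup>d+1\<^esup>)\<close>, where \<open>d + 2 = a - b\<close>, and the second factor is again
  divisible by \<open>u - v\<close>, with a cofactor that has no negative coefficients.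
\<close>

lemma two_variable_transfer:
  assumes "p \<in> I" "q \<in> I" "b + 2 \<le> a" "a \<le> N"
  shows "x p ^ a * y p ^ (N - a) * (x q ^ b * y q ^ (N - b))
       + x q ^ a * y q ^ (N - a) * (x p ^ b * y p ^ (N - b))
       - x p ^ (a - 1) * y p ^ (N - (a - 1)) * (x q ^ (b + 1) * y q ^ (N - (b + 1)))
       - x q ^ (a - 1) * y q ^ (N - (a - 1)) * (x p ^ (b + 1) * y p ^ (N - (b + 1))) \<in> S"
    (is "?L \<in> S")
proof -
  define d where "d = a - b - 2"
  define e where "e = N - a"
  define u v where "u = x p * y q" and "v = x q * y p"
  have a: "a = b + d + 2" and N: "N = b + d + 2 + e"
    using assms by (simp_all add: d_def e_def)
  have "?L = (x p * x q) ^ b * (y p * y q) ^ e * ((u - v) * (u ^ Suc d - v ^ Suc d))"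
    by (simp add: a N u_def v_def algebra_simps power_add power_mult_distrib power2_eq_square)
  also have "(u - v) * (u ^ Suc d - v ^ Suc d)
      = (u - v)\<^sup>2 * (\<Sum>i<Suc d. v ^ (Suc d - Suc i) * u ^ i)"
    by (simp only: power_diff_sumr2[of u "Suc d" v] power2_eq_square mult.assoc)
  finally have L: "?L = (x p * x q) ^ b * (y p * y q) ^ e
      * ((u - v)\<^sup>2 * (\<Sum>i<Suc d. v ^ (Suc d - Suc i) * u ^ i))" .
  have uv: "u \<in> S" "v \<in> S" "(u - v)\<^sup>2 \<in> S"
    using assms cross_square[of p q] by (auto simp: u_def v_def intro: mult x y)
  have "(x p * x q) ^ b * (y p * y q) ^ e \<in> S"
    using assms by (intro mult power x y)
  moreover have "(\<Sum>i<Suc d. v ^ (Suc d - Suc i) * u ^ i) \<in> S"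
    using uv by (intro sum mult power)
  ultimately show ?thesis
    unfolding L using uv(3) by (blast intro: mult)
qed

text \<open>
  The summands for \<open>\<pi>\<close> and for \<open>\<pi>\<close> composed with the transposition of \<open>i\<close> and \<open>j\<close> have the same
  factors outside these two positions. Summed over both, what remains is the two-variable transfer
  at \<open>p = \<pi> i\<close> and \<open>q = \<pi> j\<close>. Every permutation is counted twice in this way, hence the factor \<open>2\<close>.
\<close>

lemma sym_monomial_transfer:
  assumes ij: "i \<in> I" "j \<in> I" and ab: "\<alpha> j + 2 \<le> \<alpha> i" "\<alpha> i \<le> N"
  shows "sym_monomial N \<alpha> - sym_monomial N (\<alpha>(i := \<alpha> i - 1, j := \<alpha> j + 1)) \<in> S"
proof -
  let ?\<beta> = "\<alpha>(i := \<alpha> i - 1, j := \<alpha> j + 1)"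
  let ?P = "{\<pi>. \<pi> permutes I}"
  let ?\<tau> = "transpose i j"
  define m where "m \<gamma> \<pi> = (\<Prod>l\<in>I. x (\<pi> l) ^ \<gamma> l * y (\<pi> l) ^ (N - \<gamma> l))"
    for \<gamma> :: "'i \<Rightarrow> nat" and \<pi> :: "'i \<Rightarrow> 'i"
  have "i \<noteq> j" using ab by auto
  have double: "of_nat 2 * sym_monomial N \<gamma> = (\<Sum>\<pi>\<in>?P. m \<gamma> \<pi> + m \<gamma> (\<pi> \<circ> ?\<tau>))" for \<gamma>
    using sum_permutations_compose_right[OF permutes_swap_id[OF ij], of "m \<gamma>"]
    by (simp add: sym_monomial_def m_def sum.distrib)
  have "m \<alpha> \<pi> + m \<alpha> (\<pi> \<circ> ?\<tau>) - (m ?\<beta> \<pi> + m ?\<beta> (\<pi> \<circ> ?\<tau>)) \<in> S" if "\<pi> permutes I" for \<pi>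
  proof -
    let ?R = "I - {i} - {j}"
    define r where "r = (\<Prod>l\<in>?R. x (\<pi> l) ^ \<alpha> l * y (\<pi> l) ^ (N - \<alpha> l))"
    have split: "m \<gamma> \<rho> = x (\<rho> i) ^ \<gamma> i * y (\<rho> i) ^ (N - \<gamma> i)
        * (x (\<rho> j) ^ \<gamma> j * y (\<rho> j) ^ (N - \<gamma> j)) * r"
      if "\<And>l. l \<in> ?R \<Longrightarrow> \<gamma> l = \<alpha> l" "\<And>l. l \<in> ?R \<Longrightarrow> \<rho> l = \<pi> l" for \<gamma> \<rho>
    proof -
      have "(\<Prod>l\<in>?R. x (\<rho> l) ^ \<gamma> l * y (\<rho> l) ^ (N - \<gamma> l)) = r"
        unfolding r_def using that by (intro prod.cong) auto
      then show ?thesis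
        using ij \<open>i \<noteq> j\<close> finite
        by (simp add: m_def prod.remove[of I i] prod.remove[of "I - {i}" j] mult.assoc)
    qed
    have \<tau>: "(\<pi> \<circ> ?\<tau>) l = \<pi> l" if "l \<in> ?R" for l
      using that by (auto simp: transpose_def)
    have \<beta>: "?\<beta> l = \<alpha> l" if "l \<in> ?R" for l
      using that by auto
    have \<beta>_ij: "?\<beta> i = \<alpha> i - 1" "?\<beta> j = \<alpha> j + 1"
      using \<open>i \<noteq> j\<close> by auto
    have \<tau>_ij: "(\<pi> \<circ> ?\<tau>) i = \<pi> j" "(\<pi> \<circ> ?\<tau>) j = \<pi> i"
      by simp_all
    note eqs = split[of \<alpha> \<pi>, OF refl refl]
      split[of \<alpha> "\<pi> \<circ> ?\<tau>", OF refl \<tau>, unfolded \<tau>_ij]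
      split[of ?\<beta> \<pi>, OF \<beta> refl, unfolded \<beta>_ij]
      split[of ?\<beta> "\<pi> \<circ> ?\<tau>", OF \<beta> \<tau>, unfolded \<beta>_ij \<tau>_ij]
    have "m \<alpha> \<pi> + m \<alpha> (\<pi> \<circ> ?\<tau>) - (m ?\<beta> \<pi> + m ?\<beta> (\<pi> \<circ> ?\<tau>)) =
      (x (\<pi> i) ^ \<alpha> i * y (\<pi> i) ^ (N - \<alpha> i) * (x (\<pi> j) ^ \<alpha> j * y (\<pi> j) ^ (N - \<alpha> j))
       + x (\<pi> j) ^ \<alpha> i * y (\<pi> j) ^ (N - \<alpha> i) * (x (\<pi> i) ^ \<alpha> j * y (\<pi> i) ^ (N - \<alpha> j))
       - x (\<pi> i) ^ (\<alpha> i - 1) * y (\<pi> i) ^ (N - (\<alpha> i - 1))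
         * (x (\<pi> j) ^ (\<alpha> j + 1) * y (\<pi> j) ^ (N - (\<alpha> j + 1)))
       - x (\<pi> j) ^ (\<alpha> i - 1) * y (\<pi> j) ^ (N - (\<alpha> i - 1))
         * (x (\<pi> i) ^ (\<alpha> j + 1) * y (\<pi> i) ^ (N - (\<alpha> j + 1)))) * r"
      by (simp only: eqs left_diff_distrib distrib_right diff_diff_add add.assoc)
    also have "\<dots> \<in> S"
    proof (rule mult)
      have "\<pi> l \<in> I" if "l \<in> I" for l
        using that \<open>\<pi> permutes I\<close> by (simp add: permutes_in_image)
      then show "r \<in> S"
        unfolding r_def by (intro prod mult power x y) auto
    qed (use that ij ab in \<open>intro two_variable_transfer, auto simp: permutes_in_image\<close>)
    finally show ?thesis .
  qed
  then have "of_nat 2 * (sym_monomial N \<alpha> - sym_monomial N ?\<beta>) \<in> S"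
    unfolding right_diff_distrib double sum_subtractf[symmetric] by (intro sum) auto
  then show ?thesis
    using divide[of 2] by simp
qed

text \<open>
  Induction on the total excess over the mean \<open>k\<close>, in truncated subtraction: a unit moved from an
  entry above \<open>k\<close> to one below \<open>k\<close> lowers it by exactly one. As the mean is \<open>k\<close>, an entry above
  \<open>k\<close> forces one below \<open>k\<close>, so that the induction stops only at the constant vector.
\<close>

lemma sym_monomial_level:
  assumes "(\<Sum>i\<in>I. \<alpha> i) = card I * k" "\<And>i. i \<in> I \<Longrightarrow> \<alpha> i \<le> N"
  shows "sym_monomial N \<alpha> - sym_monomial N (\<lambda>_. k) \<in> S"
  using assms
proof (induction "\<Sum>i\<in>I. \<alpha> i - k" arbitrary: \<alpha>)
  case 0
  then have le: "\<alpha> i \<le> k" if "i \<in> I" for i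
    using that finite by simp
  have "\<alpha> i = k" if "i \<in> I" for i
  proof (rule ccontr)
    assume "\<alpha> i \<noteq> k"
    then have "(\<Sum>i\<in>I. \<alpha> i) < (\<Sum>i\<in>I. k)"
      using le that finite by (intro sum_strict_mono_ex1) (auto simp: nat_less_le)
    then show False using "0.prems" by simp
  qed
  then have "sym_monomial N \<alpha> = sym_monomial N (\<lambda>_. k)"
    by (rule sym_monomial_cong)
  then show ?case by (simp add: zero)
next
  case (Suc m)
  obtain i where i: "i \<in> I" "k < \<alpha> i"
  proof -
    have "(\<Sum>i\<in>I. \<alpha> i - k) \<noteq> 0" using Suc.hyps(2) by simp
    then show ?thesis using that finite by auto
  qed
  obtain j where j: "j \<in> I" "\<alpha> j < k"
  proof -
    have "\<not> (\<forall>j\<in>I. k \<le> \<alpha> j)"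
    proof
      assume "\<forall>j\<in>I. k \<le> \<alpha> j"
      then have "(\<Sum>i\<in>I. k) < (\<Sum>i\<in>I. \<alpha> i)"
        using i finite by (intro sum_strict_mono_ex1) auto
      then show False using Suc.prems(1) by simp
    qed
    then show ?thesis using that by (auto simp: not_le)
  qed
  have "i \<noteq> j" using i j by auto
  define \<beta> where "\<beta> = \<alpha>(i := \<alpha> i - 1, j := \<alpha> j + 1)"
  have split: "(\<Sum>l\<in>I. f l) = f i + (f j + (\<Sum>l\<in>I - {i} - {j}. f l))" for f :: "'i \<Rightarrow> nat"
    using i j \<open>i \<noteq> j\<close> finite by (simp add: sum.remove[of I i] sum.remove[of "I - {i}" j])
  have rest: "(\<Sum>l\<in>I - {i} - {j}. f (\<beta> l)) = (\<Sum>l\<in>I - {i} - {j}. f (\<alpha> l))" for f :: "nat \<Rightarrow> nat"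
    by (intro sum.cong) (auto simp: \<beta>_def)
  have "(\<Sum>l\<in>I. \<beta> l) = (\<Sum>l\<in>I. \<alpha> l)"
    unfolding split rest[of "\<lambda>t. t"] using i \<open>i \<noteq> j\<close> by (simp add: \<beta>_def)
  moreover have "m = (\<Sum>l\<in>I. \<beta> l - k)"
    using Suc.hyps(2) i j \<open>i \<noteq> j\<close> unfolding split rest[of "\<lambda>t. t - k"] by (simp add: \<beta>_def)
  moreover have "\<beta> l \<le> N" if "l \<in> I" for l
    using Suc.prems(2)[OF that] Suc.prems(2)[OF i(1)] i j by (auto simp: \<beta>_def)
  ultimately have "sym_monomial N \<beta> - sym_monomial N (\<lambda>_. k) \<in> S"
    using Suc.hyps(1)[of \<beta>] Suc.prems(1) by simp
  moreover have "sym_monomial N \<alpha> - sym_monomial N \<beta> \<in> S"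
    unfolding \<beta>_def using i j Suc.prems(2) by (intro sym_monomial_transfer) auto
  ultimately show ?case
    using add[of "sym_monomial N \<alpha> - sym_monomial N \<beta>"] by (force simp: algebra_simps)
qed

lemma prod_permute: "\<pi> permutes I \<Longrightarrow> (\<Prod>i\<in>I. f (\<pi> i)) = (\<Prod>i\<in>I. f i)"
  by (rule prod.reindex_bij_betw) (rule permutes_imp_bij)

text \<open>
  The symmetrized monomials of all subsets \<open>A\<close> add up to one copy of the product for each
  permutation: exchanging the two sums, each permutation just renames the factors. The levelled
  ones add up to the binomial expansion. The exponent is the number of indices so that the mean of
  the vector that is \<open>N\<close> on \<open>A\<close> and \<open>0\<close> elsewhere is the integer \<open>|A|\<close>.
\<close>

lemma prod_power_add_diff:
  assumes N: "card I = N"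
  shows "(\<Prod>i\<in>I. x i ^ N + y i ^ N) - ((\<Prod>i\<in>I. x i) + (\<Prod>i\<in>I. y i)) ^ N \<in> S"
proof -
  define \<alpha> where "\<alpha> A i = (if i \<in> A then N else 0)" for A and i :: 'i
  let ?X = "\<Prod>i\<in>I. x i" and ?Y = "\<Prod>i\<in>I. y i"
  let ?P = "{\<pi>. \<pi> permutes I}"
  have card_P: "card ?P = fact N"
    using card_permutations[OF N finite] .
  have "(\<Sum>A\<in>Pow I. sym_monomial N (\<alpha> A))
      = (\<Sum>\<pi>\<in>?P. \<Sum>A\<in>Pow I. \<Prod>i\<in>I. x (\<pi> i) ^ \<alpha> A i * y (\<pi> i) ^ (N - \<alpha> A i))"
    unfolding sym_monomial_def by (rule sum.swap)
  also have "\<dots> = (\<Sum>\<pi>\<in>?P. \<Prod>i\<in>I. x i ^ N + y i ^ N)"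
  proof (intro sum.cong refl)
    fix \<pi> assume "\<pi> \<in> ?P"
    have "(\<Prod>i\<in>I. x (\<pi> i) ^ \<alpha> A i * y (\<pi> i) ^ (N - \<alpha> A i))
        = (\<Prod>i\<in>A. x (\<pi> i) ^ N) * (\<Prod>i\<in>I - A. y (\<pi> i) ^ N)" if "A \<in> Pow I" for A
    proof -
      have "A \<subseteq> I" using that by simp
      then show ?thesis
        using finite by (simp add: prod.subset_diff[of A I] \<alpha>_def mult.commute)
    qed
    then have "(\<Sum>A\<in>Pow I. \<Prod>i\<in>I. x (\<pi> i) ^ \<alpha> A i * y (\<pi> i) ^ (N - \<alpha> A i))
        = (\<Prod>i\<in>I. x (\<pi> i) ^ N + y (\<pi> i) ^ N)"
      using finite by (simp add: prod_add)
    also have "\<dots> = (\<Prod>i\<in>I. x i ^ N + y i ^ N)"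
      using \<open>\<pi> \<in> ?P\<close> by (simp add: prod_permute[where f = "\<lambda>i. x i ^ N + y i ^ N"])
    finally show "(\<Sum>A\<in>Pow I. \<Prod>i\<in>I. x (\<pi> i) ^ \<alpha> A i * y (\<pi> i) ^ (N - \<alpha> A i))
        = (\<Prod>i\<in>I. x i ^ N + y i ^ N)" .
  qed
  finally have upper: "(\<Sum>A\<in>Pow I. sym_monomial N (\<alpha> A))
      = of_nat (fact N) * (\<Prod>i\<in>I. x i ^ N + y i ^ N)"
    by (simp add: card_P)
  have const: "sym_monomial N (\<lambda>_. k) = of_nat (fact N) * (?X ^ k * ?Y ^ (N - k))" for k
  proof -
    have "sym_monomial N (\<lambda>_. k) = (\<Sum>\<pi>\<in>?P. ?X ^ k * ?Y ^ (N - k))"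
      unfolding sym_monomial_def
      by (intro sum.cong refl)
        (simp add: prod.distrib prod_power_distrib[symmetric] prod_permute)
    then show ?thesis by (simp add: card_P)
  qed
  have "(?X + ?Y) ^ N = (\<Prod>i\<in>I. ?X + ?Y)"
    using N by simp
  also have "\<dots> = (\<Sum>A\<in>Pow I. ?X ^ card A * ?Y ^ (N - card A))"
    using finite by (subst prod_add)
      (auto intro!: sum.cong simp: N card_Diff_subset finite_subset)
  finally have lower: "(\<Sum>A\<in>Pow I. sym_monomial N (\<lambda>_. card A)) = of_nat (fact N) * (?X + ?Y) ^ N"
    by (simp add: const sum_distrib_left)
  have "sym_monomial N (\<alpha> A) - sym_monomial N (\<lambda>_. card A) \<in> S" if "A \<in> Pow I" for A
  proof (rule sym_monomial_level)
    have "(\<Sum>i\<in>I. \<alpha> A i) = (\<Sum>i\<in>I \<inter> A. N)"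
      using finite by (simp add: \<alpha>_def sum.If_cases)
    then show "(\<Sum>i\<in>I. \<alpha> A i) = card I * card A"
      using that N by (simp add: Int_absorb1)
  qed (simp add: \<alpha>_def)
  then have "(\<Sum>A\<in>Pow I. sym_monomial N (\<alpha> A) - sym_monomial N (\<lambda>_. card A)) \<in> S"
    by (rule sum)
  then have "of_nat (fact N) * ((\<Prod>i\<in>I. x i ^ N + y i ^ N) - (?X + ?Y) ^ N) \<in> S"
    by (simp only: sum_subtractf upper lower right_diff_distrib)
  then show ?thesis
    by (rule divide[rotated]) simp
qed

end

section \<open>Polynomials in the given variables\<close>

lemma poly_ring_const: "Poly_Mapping.single 0 c \<in> poly_ring n"
  by (simp add: poly_ring_def)

lemma poly_ring_1: "1 \<in> poly_ring n"
  using poly_ring_const[of 1 n] by simp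

lemma poly_ring_indet: "v \<in> XVar ` {1..n} \<union> YVar ` {1..n} \<Longrightarrow> indet v \<in> poly_ring n"
  by (simp add: poly_ring_def indet_def)

lemma poly_ring_diff: "p \<in> poly_ring n \<Longrightarrow> q \<in> poly_ring n \<Longrightarrow> p - q \<in> poly_ring n"
  using keys_diff[of p q] unfolding poly_ring_def by blast

lemma poly_ring_mult:
  assumes "p \<in> poly_ring n" "q \<in> poly_ring n"
  shows "p * q \<in> poly_ring n"
  unfolding poly_ring_def
proof (intro CollectI ballI)
  fix m assume "m \<in> Poly_Mapping.keys (p * q)"
  then obtain a b where "m = a + b" "a \<in> Poly_Mapping.keys p" "b \<in> Poly_Mapping.keys q"
    using keys_mult[of p q] by auto
  then show "Poly_Mapping.keys m \<subseteq> XVar ` {1..n} \<union> YVar ` {1..n}"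
    using assms keys_add[of a b] unfolding poly_ring_def by fast
qed

lemma poly_ring_power: "p \<in> poly_ring n \<Longrightarrow> p ^ k \<in> poly_ring n"
  by (induction k) (auto intro: poly_ring_1 poly_ring_mult)

lemma poly_ring_prod: "(\<And>i. i \<in> A \<Longrightarrow> f i \<in> poly_ring n) \<Longrightarrow> prod f A \<in> poly_ring n"
  by (induction A rule: infinite_finite_induct) (auto intro: poly_ring_1 poly_ring_mult)

definition xy_monomial :: "nat \<Rightarrow> (nat \<Rightarrow> nat) \<Rightarrow> (nat \<Rightarrow> nat) \<Rightarrow> rpoly" where
  "xy_monomial n a b = (\<Prod>j = 1..n. xvar j ^ a j * yvar j ^ b j)"

lemma poly_ring_xy_monomial: "xy_monomial n a b \<in> poly_ring n"
  unfolding xy_monomial_def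
  by (intro poly_ring_prod poly_ring_mult poly_ring_power poly_ring_indet) auto

lemma xy_monomial_0: "xy_monomial n (\<lambda>_. 0) (\<lambda>_. 0) = 1"
  by (simp add: xy_monomial_def)

lemma xy_monomial_mult:
  "xy_monomial n a b * xy_monomial n a' b' = xy_monomial n (\<lambda>j. a j + a' j) (\<lambda>j. b j + b' j)"
  by (simp add: xy_monomial_def power_add prod.distrib[symmetric] mult_ac)

lemma xy_monomial_xvar:
  assumes "i \<in> {1..n}"
  shows "xy_monomial n (\<lambda>j. if j = i then 1 else 0) (\<lambda>_. 0) = xvar i"
  using assms by (simp add: xy_monomial_def if_distrib[of "\<lambda>k. _ ^ k"] prod.delta cong: if_cong)

lemma xy_monomial_yvar:
  assumes "i \<in> {1..n}"
  shows "xy_monomial n (\<lambda>_. 0) (\<lambda>j. if j = i then 1 else 0) = yvar i"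
  using assms by (simp add: xy_monomial_def if_distrib[of "\<lambda>k. _ ^ k"] prod.delta cong: if_cong)

section \<open>The semiring generated by the variables and the squares\<close>

text \<open>
  Arbitrary exponents are allowed here, because products of square-free monomials are not
  square-free. Closure under multiplication is then immediate, and the exponents are reduced
  modulo \<open>2\<close> only once, in \<open>square_cone_subset_S2\<close>.
\<close>

inductive_set square_cone :: "nat \<Rightarrow> rpoly set" for n where
  zero: "0 \<in> square_cone n"
| add_term: "p \<in> square_cone n \<Longrightarrow> q \<in> poly_ring n \<Longrightarrow> p + q\<^sup>2 * xy_monomial n a b \<in> square_cone n"

lemma square_cone_term: "q \<in> poly_ring n \<Longrightarrow> q\<^sup>2 * xy_monomial n a b \<in> square_cone n"
  using square_cone.add_term[OF square_cone.zero] by simp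

lemma square_cone_square: "q \<in> poly_ring n \<Longrightarrow> q\<^sup>2 \<in> square_cone n"
  using square_cone_term[of q n "\<lambda>_. 0" "\<lambda>_. 0"] by (simp add: xy_monomial_0)

lemma square_cone_xy_monomial: "xy_monomial n a b \<in> square_cone n"
  using square_cone_term[OF poly_ring_1, of n a b] by simp

lemma square_cone_add:
  assumes "p \<in> square_cone n" "q \<in> square_cone n"
  shows "p + q \<in> square_cone n"
  using assms(2)
proof induction
  case zero
  then show ?case using assms(1) by simp
next
  case (add_term q' q a b)
  then show ?case
    using square_cone.add_term[of "p + q'" n q a b] by (simp add: add.assoc)
qed

lemma square_cone_mult_term:
  assumes "p \<in> square_cone n" "r \<in> poly_ring n"
  shows "p * (r\<^sup>2 * xy_monomial n c d) \<in> square_cone n"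
  using assms(1)
proof induction
  case zero
  then show ?case by (simp add: square_cone.zero)
next
  case (add_term p q a b)
  have "q\<^sup>2 * xy_monomial n a b * (r\<^sup>2 * xy_monomial n c d)
      = (q * r)\<^sup>2 * (xy_monomial n a b * xy_monomial n c d)"
    by (simp add: power_mult_distrib mult_ac)
  then have "(p + q\<^sup>2 * xy_monomial n a b) * (r\<^sup>2 * xy_monomial n c d)
      = p * (r\<^sup>2 * xy_monomial n c d)
        + (q * r)\<^sup>2 * xy_monomial n (\<lambda>j. a j + c j) (\<lambda>j. b j + d j)"
    by (simp only: distrib_right xy_monomial_mult)
  then show ?case
    using add_term assms(2) by (simp add: square_cone.add_term poly_ring_mult)
qed

lemma square_cone_mult:
  assumes "p \<in> square_cone n" "q \<in> square_cone n"
  shows "p * q \<in> square_cone n"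
  using assms(2)
proof induction
  case zero
  then show ?case by (simp add: square_cone.zero)
next
  case (add_term q' q a b)
  then show ?case
    using assms(1) by (simp add: distrib_left square_cone_add square_cone_mult_term)
qed

lemma square_cone_divide:
  assumes "0 < m" "of_nat m * p \<in> square_cone n"
  shows "p \<in> square_cone n"
proof -
  let ?c = "Poly_Mapping.single 0 (sqrt (1 / real m)) :: rpoly"
  have "?c\<^sup>2 * of_nat m = Poly_Mapping.single 0 (sqrt (1 / real m) * sqrt (1 / real m) * real m)"
    by (simp only: power2_eq_square mult_single single_of_nat[symmetric] add_0)
  also have "\<dots> = 1"
    using assms(1) by simp
  finally have "?c\<^sup>2 * (of_nat m * p) = p"
    by (simp add: mult.assoc[symmetric])
  then show ?thesis
    using square_cone_mult[OF square_cone_square[OF poly_ring_const] assms(2)] by metis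
qed

section \<open>The normal form with square-free monomials\<close>

lemma sums_of_squares_0: "0 \<in> sums_of_squares n"
  unfolding sums_of_squares_def by (intro CollectI exI[of _ 0]) simp

lemma sums_of_squares_square:
  assumes "q \<in> poly_ring n"
  shows "q\<^sup>2 \<in> sums_of_squares n"
  unfolding sums_of_squares_def
  using assms by (intro CollectI exI[of _ 1] exI[of _ "\<lambda>_. q"]) simp

lemma sums_of_squares_add:
  assumes "p \<in> sums_of_squares n" "p' \<in> sums_of_squares n"
  shows "p + p' \<in> sums_of_squares n"
proof -
  obtain k :: nat and q where p: "p = (\<Sum>i<k. (q i)\<^sup>2)" "\<forall>i<k. q i \<in> poly_ring n"
    using assms(1) unfolding sums_of_squares_def by blast
  obtain l :: nat and q' where p': "p' = (\<Sum>i<l. (q' i)\<^sup>2)" "\<forall>i<l. q' i \<in> poly_ring n"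
    using assms(2) unfolding sums_of_squares_def by blast
  define r where "r i = (if i < k then q i else q' (i - k))" for i
  have "(\<Sum>i<k + m. (r i)\<^sup>2) = p + (\<Sum>i<m. (q' i)\<^sup>2)" for m
    by (induction m) (simp_all add: p r_def add.assoc)
  then have "p + p' = (\<Sum>i<k + l. (r i)\<^sup>2)"
    using p' by simp
  moreover have "\<forall>i<k + l. r i \<in> poly_ring n"
    using p p' by (auto simp: r_def)
  ultimately show ?thesis
    unfolding sums_of_squares_def by blast
qed

abbreviation exponents :: "nat \<Rightarrow> (nat \<Rightarrow> nat) set" where
  "exponents n \<equiv> {1..n} \<rightarrow>\<^sub>E {0, 1}"

lemma S2_eq:
  "S2 n = {\<Sum>\<epsilon>\<in>exponents n. \<Sum>\<delta>\<in>exponents n. r \<epsilon> \<delta> * xy_monomial n \<epsilon> \<delta> | r.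
             \<forall>\<epsilon>\<in>exponents n. \<forall>\<delta>\<in>exponents n. r \<epsilon> \<delta> \<in> sums_of_squares n}"
  by (simp add: S2_def xy_monomial_def)

lemma S2_0: "0 \<in> S2 n"
  unfolding S2_eq by (intro CollectI exI[of _ "\<lambda>_ _. 0"]) (simp add: sums_of_squares_0)

lemma S2_add:
  assumes "p \<in> S2 n" "p' \<in> S2 n"
  shows "p + p' \<in> S2 n"
proof -
  obtain r where r: "p = (\<Sum>\<epsilon>\<in>exponents n. \<Sum>\<delta>\<in>exponents n. r \<epsilon> \<delta> * xy_monomial n \<epsilon> \<delta>)"
    "\<forall>\<epsilon>\<in>exponents n. \<forall>\<delta>\<in>exponents n. r \<epsilon> \<delta> \<in> sums_of_squares n"
    using assms(1) unfolding S2_eq by blast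
  obtain r' where r': "p' = (\<Sum>\<epsilon>\<in>exponents n. \<Sum>\<delta>\<in>exponents n. r' \<epsilon> \<delta> * xy_monomial n \<epsilon> \<delta>)"
    "\<forall>\<epsilon>\<in>exponents n. \<forall>\<delta>\<in>exponents n. r' \<epsilon> \<delta> \<in> sums_of_squares n"
    using assms(2) unfolding S2_eq by blast
  show ?thesis
    unfolding S2_eq
  proof (intro CollectI exI[of _ "\<lambda>\<epsilon> \<delta>. r \<epsilon> \<delta> + r' \<epsilon> \<delta>"] conjI ballI)
    show "p + p' = (\<Sum>\<epsilon>\<in>exponents n. \<Sum>\<delta>\<in>exponents n. (r \<epsilon> \<delta> + r' \<epsilon> \<delta>) * xy_monomial n \<epsilon> \<delta>)"
      by (simp only: r(1) r'(1) distrib_right sum.distrib)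
  qed (use r(2) r'(2) in \<open>blast intro: sums_of_squares_add\<close>)
qed

text \<open>
  The even part of a monomial is absorbed into the square, which leaves the exponents modulo \<open>2\<close>.
\<close>

lemma S2_term:
  assumes "q \<in> poly_ring n"
  shows "q\<^sup>2 * xy_monomial n a b \<in> S2 n"
proof -
  define e d where "e = restrict (\<lambda>j. a j mod 2) {1..n}" and "d = restrict (\<lambda>j. b j mod 2) {1..n}"
  define w where "w = q * xy_monomial n (\<lambda>j. a j div 2) (\<lambda>j. b j div 2)"
  define r where "r \<epsilon> \<delta> = (if \<delta> = d then if \<epsilon> = e then w\<^sup>2 else 0 else 0)" for \<epsilon> \<delta> :: "nat \<Rightarrow> nat"
  have ed: "e \<in> exponents n" "d \<in> exponents n"
    by (auto simp: e_def d_def)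
  have fin: "finite (exponents n)"
    by (intro finite_PiE) auto
  have "xy_monomial n a b = (xy_monomial n (\<lambda>j. a j div 2) (\<lambda>j. b j div 2))\<^sup>2 * xy_monomial n e d"
    unfolding power2_eq_square xy_monomial_mult unfolding xy_monomial_def
    by (intro prod.cong refl) (simp add: e_def d_def mult_2[symmetric])
  then have "q\<^sup>2 * xy_monomial n a b = w\<^sup>2 * xy_monomial n e d"
    by (simp add: w_def power_mult_distrib mult_ac)
  also have "\<dots> = (\<Sum>\<epsilon>\<in>exponents n. \<Sum>\<delta>\<in>exponents n. r \<epsilon> \<delta> * xy_monomial n \<epsilon> \<delta>)"
    using ed fin by (simp add: r_def if_distrib[of "\<lambda>t. t * _"] sum.delta cong: if_cong)
  finally show ?thesis
    unfolding S2_eq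
    using assms by (auto simp: r_def w_def sums_of_squares_0
        intro!: exI[of _ r] sums_of_squares_square poly_ring_mult poly_ring_xy_monomial)
qed

lemma square_cone_subset_S2: "square_cone n \<subseteq> S2 n"
proof
  fix p assume "p \<in> square_cone n"
  then show "p \<in> S2 n"
    by induction (auto intro: S2_0 S2_add S2_term)
qed

theorem theorem6:
  fixes n :: nat
  assumes "n \<ge> 1"
  shows "prod_pow_diff n \<in> S2 n"
proof -
  interpret cross_square_semiring "square_cone n" xvar yvar "{1..n}"
  proof
    show "1 \<in> square_cone n"
      using square_cone_square[OF poly_ring_1] by simp
    show "xvar i \<in> square_cone n" if "i \<in> {1..n}" for i
      using xy_monomial_xvar[OF that] square_cone_xy_monomial by metis
    show "yvar i \<in> square_cone n" if "i \<in> {1..n}" for i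
      using xy_monomial_yvar[OF that] square_cone_xy_monomial by metis
    show "(xvar i * yvar j - xvar j * yvar i)\<^sup>2 \<in> square_cone n"
      if "i \<in> {1..n}" "j \<in> {1..n}" for i j
      using that
      by (intro square_cone_square poly_ring_diff poly_ring_mult poly_ring_indet) auto
  qed (auto intro: square_cone.zero square_cone_add square_cone_mult square_cone_divide)
  show ?thesis
    using prod_power_add_diff square_cone_subset_S2 by (auto simp: prod_pow_diff_def)
qed

end
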